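(* Let $G$ be an infinite discrete group and let $(X,G)$ be a minimal system which admits a $G$-invariant Borel probability measure. Then the following statements are equivalent: (1) $(X,G)$ is almost pairwise IP$^*$-equicontinuous; (2) $(X,G)$ is point-distal and the proximal relation $P(X,G)$ is closed in $X\times X$; (3) the factor map $\pi\colon (X,G)\to (X_d,G)$ to the maximal distal factor $(X_d,G)$ of $(X,G)$ is almost one-to-one.
   Context: A system $(X,G)$ consists of a (nonempty) compact metric space $X$ with compatible metric $d$ and an infinite discrete group $G$ acting continuously on $X$. It is minimal if it has no proper nonempty closed $G$-invariant subset. A Borel probability measure $\mu$ is $G$-invariant if $\mu(gA)=\mu(A)$ for all $g\in G$ and Borel $A$. A subset of $X$ is residual if it contains a dense $G_\delta$ subset of $X$. For a sequence $\{p_i\}_{i=1}^\infty$ in $G$, $FP(\{p_i\}_{i=1}^\infty)=\{\prod_{i\in\alpha}p_i : \alpha\subset\mathbb{N}\text{ finite nonempty}\}$, products taken in increasing order of indices. $F\subset G$ is an IP-set if $FP(\{p_i\}_{i=1}^\infty)\subset F$ for some infinite sequence $\{p_i\}_{i=1}^\infty$ in $G$; an IP$^*$-set if it meets every IP-set in $G$. A point $x\in X$ is pairwise IP$^*$-equicontinuous if for every $\varepsilon>0$ there is a neighborhood $U$ of $x$ such that for all $y,z\in U$ the set $\{g\in G: d(gy,gz)<\varepsilon\}$ is an IP$^*$-set. $(X,G)$ is almost pairwise IP$^*$-equicontinuous if the set of pairwise IP$^*$-equicontinuous points is residual in $X$. A pair $(x,y)$ is proximal if $\inf_{g\in G}d(gx,gy)=0$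 and distal if $\inf_{g\in G}d(gx,gy)>0$. $P(X,G)\subset X\times X$ is the set of all proximal pairs. A point $x$ is distal if $(x,y)$ is a distal pair for every $y\in\overline{Gx}\setminus\{x\}$; $(X,G)$ is point-distal if the set of distal points is residual in $X$; $(X,G)$ is distal if any two distinct points form a distal pair. A factor map $\pi:(X,G)\to(Y,G)$ is a continuous $G$-equivariant surjection. It is almost one-to-one if $\{x\in X:\pi^{-1}(\pi(x))\text{ is a singleton}\}$ is residual in $X$. The maximal distal factor $(X_d,G)$ is the distal factor of $(X,G)$ such that every distal factor of $(X,G)$ is a factor of $(X_d,G)$; explicitly $X_d=X/S_d$ where $S_d$ is the smallest closed $G$-invariant equivalence relation on $X$ containing $P(X,G)$, and $\pi$ is the quotient map. *)

theory Defs
  imports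
    "HOL-Analysis.Analysis"
    "HOL-Algebra.Group_Action"
    "HOL-Probability.Probability_Measure"
begin

section \<open>Systems\<close>

text \<open>
  The phase space is a whole type of class \<^class>\<open>metric_space\<close>, so it is automatically nonempty and
  its metric \<^const>\<open>dist\<close> is the compatible metric \<open>d\<close>. Since \<open>G\<close> is discrete, continuity of
  the action amounts to continuity of every translation.
\<close>

locale dynamical_system = group_action G UNIV \<phi>
  for G (structure) and \<phi> :: "'g \<Rightarrow> 'x::metric_space \<Rightarrow> 'x" +
  assumes infinite_group: "infinite (carrier G)"
    and compact_space: "compact (UNIV :: 'x set)"
    and continuous_action: "\<And>g. g \<in> carrier G \<Longrightarrow> continuous_on UNIV (\<phi> g)"

definition minimal_system :: "('g, 'b) monoid_scheme \<Rightarrow> ('g \<Rightarrow> 'x::metric_space \<Rightarrow> 'x) \<Rightarrow> bool" where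
  "minimal_system G \<phi> \<longleftrightarrow>
     (\<forall>A. closed A \<and> A \<noteq> {} \<and> (\<forall>g\<in>carrier G. \<phi> g ` A \<subseteq> A) \<longrightarrow> A = UNIV)"

definition invariant_probability ::
    "('g, 'b) monoid_scheme \<Rightarrow> ('g \<Rightarrow> 'x::metric_space \<Rightarrow> 'x) \<Rightarrow> 'x measure \<Rightarrow> bool" where
  "invariant_probability G \<phi> \<mu> \<longleftrightarrow> prob_space \<mu> \<and> sets \<mu> = sets borel \<and>
     (\<forall>g\<in>carrier G. \<forall>A\<in>sets borel. emeasure \<mu> (\<phi> g ` A) = emeasure \<mu> A)"

definition residual :: "'x::metric_space set \<Rightarrow> bool" where
  "residual A \<longleftrightarrow> (\<exists>D\<subseteq>A. gdelta_in euclidean D \<and> closure D = UNIV)"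

section \<open>IP-sets and pairwise IP*-equicontinuity\<close>

text \<open>The product of the \<open>p i\<close>, \<open>i \<in> \<alpha>\<close>, in increasing order of indices (\<open>\<alpha>\<close> finite).\<close>

definition ordered_prod :: "('g, 'b) monoid_scheme \<Rightarrow> (nat \<Rightarrow> 'g) \<Rightarrow> nat set \<Rightarrow> 'g" where
  "ordered_prod G p \<alpha> = foldr (\<lambda>i r. p i \<otimes>\<^bsub>G\<^esub> r) (sorted_list_of_set \<alpha>) \<one>\<^bsub>G\<^esub>"

definition FP :: "('g, 'b) monoid_scheme \<Rightarrow> (nat \<Rightarrow> 'g) \<Rightarrow> 'g set" where
  "FP G p = {ordered_prod G p \<alpha> | \<alpha>. finite \<alpha> \<and> \<alpha> \<noteq> {}}"

definition IP_set :: "('g, 'b) monoid_scheme \<Rightarrow> 'g set \<Rightarrow> bool" where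
  "IP_set G F \<longleftrightarrow> F \<subseteq> carrier G \<and> (\<exists>p. range p \<subseteq> carrier G \<and> FP G p \<subseteq> F)"

definition IP_star_set :: "('g, 'b) monoid_scheme \<Rightarrow> 'g set \<Rightarrow> bool" where
  "IP_star_set G F \<longleftrightarrow> F \<subseteq> carrier G \<and> (\<forall>E. IP_set G E \<longrightarrow> F \<inter> E \<noteq> {})"

definition pairwise_IP_star_equicontinuous_point ::
    "('g, 'b) monoid_scheme \<Rightarrow> ('g \<Rightarrow> 'x::metric_space \<Rightarrow> 'x) \<Rightarrow> 'x \<Rightarrow> bool" where
  "pairwise_IP_star_equicontinuous_point G \<phi> x \<longleftrightarrow>
     (\<forall>\<epsilon>>0. \<exists>U. open U \<and> x \<in> U \<and>
        (\<forall>y\<in>U. \<forall>z\<in>U. IP_star_set G {g \<in> carrier G. dist (\<phi> g y) (\<phi> g z) < \<epsilon>}))"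

definition almost_pairwise_IP_star_equicontinuous ::
    "('g, 'b) monoid_scheme \<Rightarrow> ('g \<Rightarrow> 'x::metric_space \<Rightarrow> 'x) \<Rightarrow> bool" where
  "almost_pairwise_IP_star_equicontinuous G \<phi> \<longleftrightarrow>
     residual {x. pairwise_IP_star_equicontinuous_point G \<phi> x}"

section \<open>Proximality and distality\<close>

definition proximal_relation ::
    "('g, 'b) monoid_scheme \<Rightarrow> ('g \<Rightarrow> 'x::metric_space \<Rightarrow> 'x) \<Rightarrow> ('x \<times> 'x) set" where
  "proximal_relation G \<phi> = {(x, y). (INF g\<in>carrier G. dist (\<phi> g x) (\<phi> g y)) = 0}"

definition distal_pair ::
    "('g, 'b) monoid_scheme \<Rightarrow> ('g \<Rightarrow> 'x::metric_space \<Rightarrow> 'x) \<Rightarrow> 'x \<Rightarrow> 'x \<Rightarrow> bool" where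
  "distal_pair G \<phi> x y \<longleftrightarrow> (INF g\<in>carrier G. dist (\<phi> g x) (\<phi> g y)) > 0"

definition distal_point ::
    "('g, 'b) monoid_scheme \<Rightarrow> ('g \<Rightarrow> 'x::metric_space \<Rightarrow> 'x) \<Rightarrow> 'x \<Rightarrow> bool" where
  "distal_point G \<phi> x \<longleftrightarrow> (\<forall>y \<in> closure (orbit G \<phi> x) - {x}. distal_pair G \<phi> x y)"

definition point_distal ::
    "('g, 'b) monoid_scheme \<Rightarrow> ('g \<Rightarrow> 'x::metric_space \<Rightarrow> 'x) \<Rightarrow> bool" where
  "point_distal G \<phi> \<longleftrightarrow> residual {x. distal_point G \<phi> x}"

section \<open>Factor maps and the maximal distal factor\<close>

text \<open>
  Factors are given by a topology and an action on its underlying set, because the underlying set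
  of the maximal distal factor is a set of equivalence classes and not a type.
\<close>

definition factor_map ::
    "('g, 'b) monoid_scheme \<Rightarrow> ('g \<Rightarrow> 'x::metric_space \<Rightarrow> 'x) \<Rightarrow>
     'y topology \<Rightarrow> ('g \<Rightarrow> 'y \<Rightarrow> 'y) \<Rightarrow> ('x \<Rightarrow> 'y) \<Rightarrow> bool" where
  "factor_map G \<phi> Y \<psi> \<pi> \<longleftrightarrow>
     continuous_map euclidean Y \<pi> \<and> \<pi> ` UNIV = topspace Y \<and>
     (\<forall>g\<in>carrier G. \<forall>x. \<pi> (\<phi> g x) = \<psi> g (\<pi> x))"

definition almost_one_to_one_factor_map ::
    "('g, 'b) monoid_scheme \<Rightarrow> ('g \<Rightarrow> 'x::metric_space \<Rightarrow> 'x) \<Rightarrow>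
     'y topology \<Rightarrow> ('g \<Rightarrow> 'y \<Rightarrow> 'y) \<Rightarrow> ('x \<Rightarrow> 'y) \<Rightarrow> bool" where
  "almost_one_to_one_factor_map G \<phi> Y \<psi> \<pi> \<longleftrightarrow>
     factor_map G \<phi> Y \<psi> \<pi> \<and> residual {x. is_singleton (\<pi> -` {\<pi> x})}"

definition closed_invariant_equiv ::
    "('g, 'b) monoid_scheme \<Rightarrow> ('g \<Rightarrow> 'x::metric_space \<Rightarrow> 'x) \<Rightarrow> ('x \<times> 'x) set \<Rightarrow> bool" where
  "closed_invariant_equiv G \<phi> R \<longleftrightarrow>
     equiv UNIV R \<and> closed R \<and> (\<forall>g\<in>carrier G. \<forall>(x, y)\<in>R. (\<phi> g x, \<phi> g y) \<in> R)"

definition distal_structure_relation ::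
    "('g, 'b) monoid_scheme \<Rightarrow> ('g \<Rightarrow> 'x::metric_space \<Rightarrow> 'x) \<Rightarrow> ('x \<times> 'x) set" where
  "distal_structure_relation G \<phi> =
     \<Inter>{R. closed_invariant_equiv G \<phi> R \<and> proximal_relation G \<phi> \<subseteq> R}"

definition quotient_topology :: "('x::topological_space \<times> 'x) set \<Rightarrow> 'x set topology" where
  "quotient_topology R = topology (\<lambda>\<U>. \<U> \<subseteq> UNIV // R \<and> open (\<Union>\<U>))"

definition quotient_action :: "('g \<Rightarrow> 'x \<Rightarrow> 'x) \<Rightarrow> ('x \<times> 'x) set \<Rightarrow> 'g \<Rightarrow> 'x set \<Rightarrow> 'x set" where
  "quotient_action \<phi> R g = restrict (\<lambda>C. \<phi> g ` C) (UNIV // R)"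

definition max_distal_factor_topology ::
    "('g, 'b) monoid_scheme \<Rightarrow> ('g \<Rightarrow> 'x::metric_space \<Rightarrow> 'x) \<Rightarrow> 'x set topology" where
  "max_distal_factor_topology G \<phi> = quotient_topology (distal_structure_relation G \<phi>)"

definition max_distal_factor_action ::
    "('g, 'b) monoid_scheme \<Rightarrow> ('g \<Rightarrow> 'x::metric_space \<Rightarrow> 'x) \<Rightarrow> 'g \<Rightarrow> 'x set \<Rightarrow> 'x set" where
  "max_distal_factor_action G \<phi> = quotient_action \<phi> (distal_structure_relation G \<phi>)"

definition max_distal_factor_map ::
    "('g, 'b) monoid_scheme \<Rightarrow> ('g \<Rightarrow> 'x::metric_space \<Rightarrow> 'x) \<Rightarrow> 'x \<Rightarrow> 'x set" where
  "max_distal_factor_map G \<phi> x = distal_structure_relation G \<phi> `` {x}"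

lemma closed_invariant_equiv_distal_structure_relation:
  "closed_invariant_equiv G \<phi> (distal_structure_relation G \<phi>)"
proof -
  let ?\<R> = "{R. closed_invariant_equiv G \<phi> R \<and> proximal_relation G \<phi> \<subseteq> R}"
  have *: "equiv UNIV R" "closed R" "\<And>g x y. g \<in> carrier G \<Longrightarrow> (x, y) \<in> R \<Longrightarrow> (\<phi> g x, \<phi> g y) \<in> R"
    if "R \<in> ?\<R>" for R
    using that by (auto simp: closed_invariant_equiv_def)
  have "equiv UNIV (\<Inter>?\<R>)"
  proof (rule equivI)
    show "refl (\<Inter>?\<R>)"
      using *(1) by (meson InterI UNIV_I equivE refl_onD refl_onI)
    show "sym (\<Inter>?\<R>)"
      using *(1) by (meson InterI InterD equivE symD symI)
    show "trans (\<Inter>?\<R>)"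
      using *(1) by (meson InterI InterD equivE transD transI)
  qed simp
  moreover have "closed (\<Inter>?\<R>)"
    using *(2) by (intro closed_Inter) blast
  moreover have "\<forall>g\<in>carrier G. \<forall>(x, y)\<in>\<Inter>?\<R>. (\<phi> g x, \<phi> g y) \<in> \<Inter>?\<R>"
    using *(3) by blast
  ultimately show ?thesis
    unfolding closed_invariant_equiv_def distal_structure_relation_def by (intro conjI)
qed

lemma proximal_subset_distal_structure_relation:
  "proximal_relation G \<phi> \<subseteq> distal_structure_relation G \<phi>"
  by (auto simp: distal_structure_relation_def)

lemma openin_quotient_topology:
  assumes "equiv UNIV R"
  shows "openin (quotient_topology R) \<U> \<longleftrightarrow> \<U> \<subseteq> UNIV // R \<and> open (\<Union>\<U>)"
proof -
  have "istopology (\<lambda>\<U>. \<U> \<subseteq> UNIV // R \<and> open (\<Union>\<U>))"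
    unfolding istopology_def
  proof (intro conjI allI impI)
    fix S T assume ST: "S \<subseteq> UNIV // R \<and> open (\<Union>S)" "T \<subseteq> UNIV // R \<and> open (\<Union>T)"
    have "\<Union>(S \<inter> T) = \<Union>S \<inter> \<Union>T"
    proof
      show "\<Union>S \<inter> \<Union>T \<subseteq> \<Union>(S \<inter> T)"
      proof
        fix x assume "x \<in> \<Union>S \<inter> \<Union>T"
        then obtain C D where CD: "C \<in> S" "x \<in> C" "D \<in> T" "x \<in> D" by blast
        then have "C = D"
          using ST quotient_disj[OF assms, of C D] by blast
        with CD show "x \<in> \<Union>(S \<inter> T)" by blast
      qed
    qed blast
    with ST show "open (\<Union>(S \<inter> T))" by auto
  next
    fix \<K> assume K: "\<forall>K\<in>\<K>. K \<subseteq> UNIV // R \<and> open (\<Union>K)"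
    then show "\<Union>\<K> \<subseteq> UNIV // R" by blast
    have "\<Union>(\<Union>\<K>) = (\<Union>K\<in>\<K>. \<Union>K)" by blast
    with K show "open (\<Union>(\<Union>\<K>))" by auto
  qed blast
  then show ?thesis
    by (simp add: quotient_topology_def)
qed

lemma topspace_quotient_topology:
  assumes "equiv UNIV R"
  shows "topspace (quotient_topology R) = UNIV // R"
proof
  have "openin (quotient_topology R) (UNIV // R)"
    using assms by (simp add: openin_quotient_topology Union_quotient)
  then show "UNIV // R \<subseteq> topspace (quotient_topology R)"
    by (rule openin_subset)
  show "topspace (quotient_topology R) \<subseteq> UNIV // R"
    using openin_quotient_topology[OF assms] openin_topspace by blast
qed

lemma quotient_map_quotient_topology:
  assumes "equiv UNIV R"
  shows "quotient_map euclidean (quotient_topology R) (\<lambda>x. R `` {x})"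
proof -
  have union: "{x. R `` {x} \<in> \<U>} = \<Union>\<U>" if \<U>: "\<U> \<subseteq> UNIV // R" for \<U>
  proof (intro Set.set_eqI iffI)
    fix x assume "x \<in> {x. R `` {x} \<in> \<U>}"
    then show "x \<in> \<Union>\<U>"
      using equiv_class_self[OF assms, of x] by blast
  next
    fix x assume "x \<in> \<Union>\<U>"
    then obtain C where C: "C \<in> \<U>" "x \<in> C" by blast
    then obtain y where y: "C = R `` {y}"
      using \<U> by (meson quotientE subsetD)
    then have "C = R `` {x}"
      using C(2) equiv_class_eq[OF assms, of y x] by simp
    with C(1) show "x \<in> {x. R `` {x} \<in> \<U>}" by simp
  qed
  have "range (\<lambda>x. R `` {x}) = UNIV // R"
    unfolding quotient_def by blast
  then show ?thesis
    unfolding quotient_map_def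
    by (simp add: topspace_quotient_topology[OF assms] openin_quotient_topology[OF assms] union)
qed

lemma (in dynamical_system) quotient_action_class:
  assumes R: "closed_invariant_equiv G \<phi> R" and g: "g \<in> carrier G"
  shows "quotient_action \<phi> R g (R `` {x}) = R `` {\<phi> g x}"
proof -
  have inv: "\<And>h y z. h \<in> carrier G \<Longrightarrow> (y, z) \<in> R \<Longrightarrow> (\<phi> h y, \<phi> h z) \<in> R"
    using R by (auto simp: closed_invariant_equiv_def)
  interpret group G
    using group_hom by (simp add: group_hom_def)
  have "\<phi> g ` (R `` {x}) = R `` {\<phi> g x}"
  proof
    show "R `` {\<phi> g x} \<subseteq> \<phi> g ` (R `` {x})"
    proof
      fix z assume "z \<in> R `` {\<phi> g x}"
      then have "(\<phi> (inv g) (\<phi> g x), \<phi> (inv g) z) \<in> R"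
        using inv[of "inv g"] g by simp
      moreover have "\<phi> (inv g) (\<phi> g x) = x"
        using orbit_sym_aux[OF g, of x "\<phi> g x"] by simp
      moreover have "\<phi> g (\<phi> (inv g) z) = z"
        using orbit_sym_aux[of "inv g" z "\<phi> (inv g) z"] g by simp
      ultimately show "z \<in> \<phi> g ` (R `` {x})"
        by (metis Image_singleton_iff image_eqI)
    qed
  qed (use inv g in auto)
  then show ?thesis
    by (simp add: quotient_action_def quotientI)
qed

lemma (in dynamical_system) factor_map_max_distal_factor_map:
  "factor_map G \<phi> (max_distal_factor_topology G \<phi>) (max_distal_factor_action G \<phi>)
     (max_distal_factor_map G \<phi>)"
proof -
  note R = closed_invariant_equiv_distal_structure_relation[of G \<phi>]
  then have "equiv UNIV (distal_structure_relation G \<phi>)"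
    by (simp add: closed_invariant_equiv_def)
  note quot = quotient_map_quotient_topology[OF this]
  show ?thesis
    unfolding factor_map_def max_distal_factor_topology_def max_distal_factor_action_def
      max_distal_factor_map_def
    using quotient_imp_continuous_map[OF quot] quotient_imp_surjective_map[OF quot]
      quotient_action_class[OF R]
    by simp
qed

end

theory Submission
  imports Defs
begin

text \<open>
  A closed proximal relation \<open>P\<close> is an equivalence relation, hence equals \<open>S\<^sub>d\<close>; conversely, a closed
  invariant relation containing \<open>P\<close> which relates some point \<open>x\<^sub>0\<close> to itself only is equal to \<open>P\<close>,
  because minimality moves the first coordinate of any related pair to \<open>x\<^sub>0\<close> in the limit. As the fibre
  of \<open>\<pi>\<close> over \<open>\<pi> x\<close> is the \<open>S\<^sub>d\<close>-class of \<open>x\<close>, this settles the equivalence of (2) and (3).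

  For (1) to (2), let \<open>x\<close> be pairwise IP*-equicontinuous with \<open>(x, y)\<close> in the closure of \<open>P\<close> and
  \<open>y \<noteq> x\<close>, and take \<open>(a, b) \<in> P\<close> close to \<open>(x, y)\<close>. There is an IP-set which sends \<open>a\<close> close to
  \<open>b\<close>, and Poincare recurrence for the invariant measure allows to choose it such that it also keeps
  some point \<open>z\<close> near \<open>x\<close> in a small ball around \<open>x\<close>. Thus \<open>a\<close> and \<open>z\<close> violate the
  equicontinuity at \<open>x\<close>, so \<open>x\<close> is related by the closure of \<open>P\<close> to itself only.

  For (2) to (1), the limits of an IP-set in the space of self-maps contain an idempotent \<open>u\<close>, and every
  \<open>y\<close> is proximal to \<open>u y\<close>. If \<open>x\<close> is distal and \<open>P\<close> is closed, the points proximal to some \<open>y\<close> near \<open>x\<close>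
  are near \<open>x\<close>, so the IP-set returns any two points near \<open>x\<close> simultaneously.
\<close>

section \<open>Ordered products and the construction of IP-sets\<close>

section \<open>Ordered products\<close>

context monoid
begin

lemma ordered_prod_empty [simp]: "ordered_prod G p {} = \<one>"
  by (simp add: ordered_prod_def)

lemma foldr_mult_closed:
  assumes "range p \<subseteq> carrier G" "a \<in> carrier G"
  shows "foldr (\<lambda>i r. p i \<otimes> r) xs a \<in> carrier G"
  using assms by (induction xs) auto

lemma foldr_mult_right:
  assumes "range p \<subseteq> carrier G" "a \<in> carrier G"
  shows "foldr (\<lambda>i r. p i \<otimes> r) xs a = foldr (\<lambda>i r. p i \<otimes> r) xs \<one> \<otimes> a"
proof (induction xs)
  case (Cons i xs)
  have "p i \<in> carrier G" using assms(1) by auto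
  with Cons show ?case
    using assms foldr_mult_closed[of p \<one> xs] by (simp add: m_assoc)
qed (use assms in simp)

lemma ordered_prod_closed:
  assumes "range p \<subseteq> carrier G"
  shows "ordered_prod G p \<alpha> \<in> carrier G"
  unfolding ordered_prod_def by (intro foldr_mult_closed assms) simp

lemma ordered_prod_Un:
  assumes p: "range p \<subseteq> carrier G" and fin: "finite \<alpha>" "finite \<beta>"
    and less: "\<And>i j. i \<in> \<alpha> \<Longrightarrow> j \<in> \<beta> \<Longrightarrow> i < j"
  shows "ordered_prod G p (\<alpha> \<union> \<beta>) = ordered_prod G p \<alpha> \<otimes> ordered_prod G p \<beta>"
proof -
  have "sorted_list_of_set (\<alpha> \<union> \<beta>) = sorted_list_of_set \<alpha> @ sorted_list_of_set \<beta>"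
  proof (rule strict_sorted_equal)
    show "sorted_wrt (<) (sorted_list_of_set \<alpha> @ sorted_list_of_set \<beta>)"
      using fin less by (simp add: sorted_wrt_append)
  qed (use fin in auto)
  then show ?thesis
    using p foldr_mult_right[OF p foldr_mult_closed[OF p one_closed]]
    by (simp add: ordered_prod_def)
qed

lemma ordered_prod_insert_greatest:
  assumes p: "range p \<subseteq> carrier G" and \<alpha>: "\<alpha> \<subseteq> {..<n}"
  shows "ordered_prod G p (insert n \<alpha>) = ordered_prod G p \<alpha> \<otimes> p n"
proof -
  have "p n \<in> carrier G" using p by auto
  then have "ordered_prod G p {n} = p n" by (simp add: ordered_prod_def)
  moreover have "finite \<alpha>" using \<alpha> finite_subset by blast
  ultimately show ?thesis
    using ordered_prod_Un[OF p, of \<alpha> "{n}"] \<alpha> by auto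
qed

text \<open>The greatest index is split off because its factor stands rightmost and so acts first,
  which matches the stages of \<open>exists_FP_in\<close>.\<close>

lemma FP_elim:
  assumes "g \<in> FP G p"
  obtains n \<alpha> where "\<alpha> \<subseteq> {..<n}" "g = ordered_prod G p (insert n \<alpha>)"
proof -
  obtain \<beta> where \<beta>: "g = ordered_prod G p \<beta>" "finite \<beta>" "\<beta> \<noteq> {}"
    using assms by (auto simp: FP_def)
  have "\<beta> - {Max \<beta>} \<subseteq> {..<Max \<beta>}"
    using \<beta> by (auto simp: le_neq_implies_less)
  moreover have "insert (Max \<beta>) (\<beta> - {Max \<beta>}) = \<beta>"
    using \<beta> Max_in by blast
  ultimately show thesis using that \<beta>(1) by metis
qed

lemma IP_set_FP: "range p \<subseteq> carrier G \<Longrightarrow> IP_set G (FP G p)"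
  unfolding IP_set_def FP_def using ordered_prod_closed by blast

text \<open>
  Shrinking \<open>A\<close> to \<open>A \<inter> g\<inverse>A\<close> at every step keeps all the
  products of the chosen elements inside the original set.
\<close>

lemma exists_FP_in:
  fixes \<psi> :: "'a \<Rightarrow> 'w \<Rightarrow> 'w"
  assumes mult: "\<And>g h w. g \<in> carrier G \<Longrightarrow> h \<in> carrier G \<Longrightarrow> \<psi> (g \<otimes> h) w = \<psi> g (\<psi> h w)"
    and one: "\<And>w. \<psi> \<one> w = w"
    and step: "\<And>A. A \<in> \<F> \<Longrightarrow> \<exists>g\<in>carrier G. Q A g \<and> A \<inter> \<psi> g -` A \<in> \<F>"
    and "A0 \<in> \<F>"
  obtains p A where "range p \<subseteq> carrier G" "\<And>n. A n \<in> \<F>" "\<And>n. Q (A n) (p n)" "decseq A"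
    "\<And>n \<alpha> w. \<alpha> \<subseteq> {..<n} \<Longrightarrow> w \<in> A n \<Longrightarrow> \<psi> (ordered_prod G p \<alpha>) w \<in> A0"
    "\<And>n \<alpha> w. \<alpha> \<subseteq> {..<n} \<Longrightarrow> \<psi> (p n) w \<in> A n \<Longrightarrow> \<psi> (ordered_prod G p (insert n \<alpha>)) w \<in> A0"
proof -
  obtain c where c: "\<And>A. A \<in> \<F> \<Longrightarrow> c A \<in> carrier G \<and> Q A (c A) \<and> A \<inter> \<psi> (c A) -` A \<in> \<F>"
    using step by metis
  define A where "A = rec_nat A0 (\<lambda>_ S. S \<inter> \<psi> (c S) -` S)"
  define p where "p n = c (A n)" for n
  have A0: "A 0 = A0" and ASuc: "A (Suc n) = A n \<inter> \<psi> (p n) -` A n" for n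
    by (simp_all add: A_def p_def)
  have A: "A n \<in> \<F>" for n
    by (induction n) (use assms(4) c in \<open>simp_all add: A0 ASuc p_def\<close>)
  have p: "range p \<subseteq> carrier G"
    using A c by (auto simp: p_def)
  have dec: "decseq A"
    by (rule decseq_SucI) (simp add: ASuc)
  have *: "\<psi> (ordered_prod G p (insert n \<alpha>)) w = \<psi> (ordered_prod G p \<alpha>) (\<psi> (p n) w)"
    if "\<alpha> \<subseteq> {..<n}" for n \<alpha> w
    using that p by (simp add: ordered_prod_insert_greatest mult ordered_prod_closed range_subsetD)
  \<comment> \<open>The induction peels off the greatest index: \<open>p n\<close> acts first and
    moves \<open>A (Suc n)\<close> into \<open>A n\<close>, where the remaining product is covered
    by the induction hypothesis.\<close>
  have in_A0: "\<psi> (ordered_prod G p \<alpha>) w \<in> A0" if "\<alpha> \<subseteq> {..<n}" "w \<in> A n" for n \<alpha> w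
    using that
  proof (induction n arbitrary: \<alpha> w)
    case 0
    then show ?case by (simp add: A0 one)
  next
    case (Suc n)
    show ?case
    proof (cases "n \<in> \<alpha>")
      case True
      have "\<alpha> - {n} \<subseteq> {..<n}" using Suc.prems(1) by auto
      with * [of "\<alpha> - {n}" n w] Suc True show ?thesis
        by (simp add: insert_absorb ASuc)
    next
      case False
      then have "\<alpha> \<subseteq> {..<n}" using Suc.prems(1) less_Suc_eq by auto
      with Suc show ?thesis by (simp add: ASuc)
    qed
  qed
  \<comment> \<open>The last conclusion asks only that \<open>p n\<close> bring \<open>w\<close>
    into \<open>A n\<close>, so it also serves points outside \<open>A n\<close>.\<close>
  show thesis
    by (rule that[of p A]) (use p A c dec in_A0 * in \<open>auto simp: p_def\<close>)
qed

end

section \<open>Compact semigroups of self-maps\<close>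

section \<open>Idempotents\<close>

lemma compact_decseq_Inter_nonempty:
  fixes K :: "nat \<Rightarrow> 'a::topological_space set"
  assumes "compact (UNIV :: 'a set)" "decseq K" "\<And>n. closed (K n)" "\<And>n. K n \<noteq> {}"
  shows "(\<Inter>n. K n) \<noteq> {}"
proof -
  have "UNIV \<inter> (\<Inter>n\<in>I. K n) \<noteq> {}" if "finite I" for I
  proof -
    \<comment> \<open>\<open>insert 0\<close> keeps \<open>Max\<close> meaningful when
      \<open>I\<close> is empty.\<close>
    have "K (Max (insert 0 I)) \<subseteq> (\<Inter>n\<in>I. K n)"
      using that decseqD[OF assms(2)] by (intro INT_greatest) simp
    with assms(4) show ?thesis by blast
  qed
  then show ?thesis
    using compact_imp_fip_image[OF assms(1), of UNIV K] assms(3) by simp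
qed

text \<open>
  The maps \<open>'x \<Rightarrow> 'x\<close> carry the topology of pointwise convergence, for which composition is
  continuous in its left argument only. Existence of an idempotent is the Ellis--Numakura lemma.
\<close>

lemma continuous_on_comp_right:
  "continuous_on UNIV (\<lambda>q :: 'a \<Rightarrow> 'b::topological_space. q \<circ> r)"
  by (intro continuous_on_coordinatewise_then_product) simp

lemma compact_UNIV_fun:
  assumes "compact (UNIV :: 'b::topological_space set)"
  shows "compact (UNIV :: ('a \<Rightarrow> 'b) set)"
proof -
  have "compact_space (product_topology (\<lambda>_::'a. euclidean :: 'b topology) UNIV)"
    using assms by (subst compact_space_product_topology) (auto simp: compact_space_def)
  then show ?thesis
    by (metis compact_space_def compactin_euclidean_iff euclidean_product_topology topspace_euclidean)
qed

text \<open>By Tychonoff \<open>M\<close> is compact, so its continuous image is compact, hence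
  closed in the Hausdorff space of functions.\<close>

lemma closed_comp_right_image:
  fixes M :: "('a \<Rightarrow> 'b::t2_space) set" and r :: "'c \<Rightarrow> 'a"
  assumes "compact (UNIV :: 'b set)" "closed M"
  shows "closed ((\<lambda>q. q \<circ> r) ` M)"
proof -
  have "compact M"
    using compact_UNIV_fun[OF assms(1)] assms(2) by (metis closed_Int_compact inf_top.right_neutral)
  then have comp: "compact ((\<lambda>q. q \<circ> r) ` M)"
    by (intro compact_continuous_image continuous_on_subset[OF continuous_on_comp_right]) auto
  have "Hausdorff_space (euclidean :: 'b topology)"
    unfolding Hausdorff_space_def disjnt_def by simp (metis hausdorff)
  then have "Hausdorff_space (product_topology (\<lambda>_::'c. euclidean :: 'b topology) UNIV)"
    by (simp add: Hausdorff_space_product_topology)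
  then have "Hausdorff_space (euclidean :: ('c \<Rightarrow> 'b) topology)"
    by (simp only: euclidean_product_topology)
  from compactin_imp_closedin[OF this] comp show ?thesis
    by (simp only: compactin_euclidean_iff closed_closedin)
qed

lemma closed_fun_eq_at:
  fixes f :: "'a \<Rightarrow> 'b::t1_space"
  shows "closed {q. q \<circ> r = f}"
proof -
  have "{q. q \<circ> r = f} = (\<Inter>x. (\<lambda>q. q (r x)) -` {f x})"
    by (auto simp: fun_eq_iff)
  moreover have "closed ((\<lambda>q. q (r x)) -` {f x})" for x
    by (rule closed_vimage) simp_all
  ultimately show ?thesis by (simp add: closed_INT)
qed

lemma exists_idempotent:
  fixes S :: "('x \<Rightarrow> 'x::t2_space) set"
  assumes X: "compact (UNIV :: 'x set)" and S: "closed S" "S \<noteq> {}"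
    and comp: "\<And>q r. q \<in> S \<Longrightarrow> r \<in> S \<Longrightarrow> q \<circ> r \<in> S"
  obtains u where "u \<in> S" "u \<circ> u = u"
proof -
  \<comment> \<open>Zorn's lemma yields maximal elements, so the closed nonempty subsemigroups of
    \<open>S\<close> are represented by their complements; a maximal \<open>N\<close> gives a
    minimal subsemigroup \<open>M\<close>.\<close>
  define \<A> where
    "\<A> = {A. closed (- A) \<and> - A \<noteq> {} \<and> - A \<subseteq> S \<and> (\<forall>q\<in>- A. \<forall>r\<in>- A. q \<circ> r \<in> - A)}"
  have "\<exists>N\<in>\<A>. \<forall>A\<in>\<A>. N \<subseteq> A \<longrightarrow> A = N"
  proof (rule subset_Zorn_nonempty)
    have "- S \<in> \<A>" using S comp by (auto simp: \<A>_def)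
    then show "\<A> \<noteq> {}" by blast
    fix \<C> assume \<C>: "\<C> \<noteq> {}" "subset.chain \<A> \<C>"
    \<comment> \<open>Compactness applies because finitely many subsemigroups from a chain contain a
      common one, which is nonempty.\<close>
    have "UNIV \<inter> \<Inter>(uminus ` \<C>) \<noteq> {}"
    proof (rule compact_imp_fip[OF compact_UNIV_fun[OF X]])
      show "closed T" if "T \<in> uminus ` \<C>" for T
        using that \<C>(2) by (auto simp: subset.chain_def \<A>_def)
      fix \<D> assume "finite \<D>" "\<D> \<subseteq> uminus ` \<C>"
      then obtain \<B> where \<B>: "\<B> \<subseteq> \<C>" "finite \<B>" "\<D> = uminus ` \<B>"
        by (meson finite_subset_image)
      obtain A where A: "A \<in> \<C>" "\<Union>\<B> \<subseteq> A"
      proof (cases "\<B> = {}")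
        case True
        with \<C>(1) that show ?thesis by auto
      next
        case False
        have "subset.chain \<C> \<B>"
          using \<B>(1) \<C>(2) unfolding subset_chain_def by blast
        with False \<B>(2) have "\<Union>\<B> \<in> \<B>"
          by (intro Union_in_chain)
        with \<B>(1) that show ?thesis by blast
      qed
      then have "- A \<noteq> {}" "- A \<subseteq> \<Inter>\<D>"
        using \<C>(2) \<B>(3) by (auto simp: subset.chain_def \<A>_def)
      then show "UNIV \<inter> \<Inter>\<D> \<noteq> {}" by auto
    qed
    moreover have "- (\<Union>\<C>) = \<Inter>(uminus ` \<C>)" by auto
    moreover have "closed (\<Inter>(uminus ` \<C>))"
      using \<C>(2) by (intro closed_Inter) (auto simp: subset.chain_def \<A>_def)
    moreover have "q \<circ> r \<in> - (\<Union>\<C>)" if "q \<in> - (\<Union>\<C>)" "r \<in> - (\<Union>\<C>)" for q r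
      using that \<C>(2) by (auto simp: subset.chain_def \<A>_def subset_iff)
    moreover have "- (\<Union>\<C>) \<subseteq> S"
      using \<C> by (auto simp: subset.chain_def \<A>_def)
    ultimately show "\<Union>\<C> \<in> \<A>" by (simp add: \<A>_def)
  qed
  then obtain N where N: "N \<in> \<A>" "\<And>A. A \<in> \<A> \<Longrightarrow> N \<subseteq> A \<Longrightarrow> A = N" by blast
  define M where "M = - N"
  have M: "closed M" "M \<noteq> {}" "M \<subseteq> S" and Mcomp: "\<And>q r. q \<in> M \<Longrightarrow> r \<in> M \<Longrightarrow> q \<circ> r \<in> M"
    using N(1) by (auto simp: \<A>_def M_def)
  have min: "L = M"
    if "closed L" "L \<noteq> {}" "L \<subseteq> M" "\<And>q r. q \<in> L \<Longrightarrow> r \<in> L \<Longrightarrow> q \<circ> r \<in> L" for L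
  proof -
    have "- L \<in> \<A>" using that M(3) by (auto simp: \<A>_def)
    with N(2) that(3) show ?thesis by (auto simp: M_def)
  qed
  obtain u where u: "u \<in> M" using M(2) by blast
  \<comment> \<open>The maps \<open>q \<circ> u\<close> form a closed subsemigroup of
    \<open>M\<close>, hence all of it, so some \<open>v\<close> in \<open>M\<close> satisfies
    \<open>v \<circ> u = u\<close>.\<close>
  have "(\<lambda>q. q \<circ> u) ` M = M"
  proof (rule min)
    show "closed ((\<lambda>q. q \<circ> u) ` M)" by (rule closed_comp_right_image[OF X M(1)])
    fix q r assume "q \<in> (\<lambda>q. q \<circ> u) ` M" "r \<in> (\<lambda>q. q \<circ> u) ` M"
    then obtain q' r' where qr: "q' \<in> M" "r' \<in> M" "q = q' \<circ> u" "r = r' \<circ> u" by blast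
    then have "q \<circ> r = (q' \<circ> u \<circ> r') \<circ> u" "q' \<circ> u \<circ> r' \<in> M"
      using u Mcomp by (auto simp: o_assoc)
    then show "q \<circ> r \<in> (\<lambda>q. q \<circ> u) ` M" by (rule image_eqI)
  qed (use u Mcomp in auto)
  with u have "u \<in> (\<lambda>q. q \<circ> u) ` M" by (rule ssubst[rotated])
  then obtain v where v: "v \<in> M" "v \<circ> u = u" by (metis (lifting) imageE)
  \<comment> \<open>This closed subsemigroup contains \<open>v\<close>; by minimality it is all of
    \<open>M\<close>, so \<open>u\<close> itself belongs to it.\<close>
  have "M \<inter> {q. q \<circ> u = u} = M"
  proof (rule min)
    show "closed (M \<inter> {q. q \<circ> u = u})" by (intro closed_Int M(1) closed_fun_eq_at)
    show "q \<circ> r \<in> M \<inter> {q. q \<circ> u = u}"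
      if "q \<in> M \<inter> {q. q \<circ> u = u}" "r \<in> M \<inter> {q. q \<circ> u = u}" for q r
    proof -
      have "(q \<circ> r) \<circ> u = q \<circ> (r \<circ> u)" by (rule comp_assoc)
      with that Mcomp show ?thesis by simp
    qed
  qed (use v in auto)
  with u M(3) that show thesis by blast
qed

section \<open>Minimality and invariant measures\<close>

section \<open>Minimal systems\<close>

context dynamical_system
begin

sublocale group G
  using group_hom by (simp add: group_hom_def)

lemma act_mult: "g \<in> carrier G \<Longrightarrow> h \<in> carrier G \<Longrightarrow> \<phi> (g \<otimes> h) x = \<phi> g (\<phi> h x)"
  by (simp add: composition_rule)

lemma act_one [simp]: "\<phi> \<one> x = x"
  by (simp flip: id_eq_one)

lemma act_inv [simp]:
  assumes "g \<in> carrier G"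
  shows "\<phi> (inv g) (\<phi> g x) = x" "\<phi> g (\<phi> (inv g) x) = x"
  by (simp_all add: assms flip: act_mult)

text \<open>Invariance of a measure is stated for images; written as preimages they are open or
  Borel by continuity.\<close>

lemma act_image:
  assumes "g \<in> carrier G"
  shows "\<phi> g ` A = \<phi> (inv g) -` A"
proof
  show "\<phi> g ` A \<subseteq> \<phi> (inv g) -` A" using assms by auto
  show "\<phi> (inv g) -` A \<subseteq> \<phi> g ` A"
  proof
    fix y assume "y \<in> \<phi> (inv g) -` A"
    then show "y \<in> \<phi> g ` A"
      using assms by (intro image_eqI[of _ _ "\<phi> (inv g) y"]) auto
  qed
qed

lemma continuous_act: "g \<in> carrier G \<Longrightarrow> continuous_on A (\<phi> g)"
  using continuous_action continuous_on_subset by blast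

lemma open_act_vimage: "g \<in> carrier G \<Longrightarrow> open U \<Longrightarrow> open (\<phi> g -` U)"
  using continuous_act by (simp add: open_vimage)

lemma closed_act_vimage: "g \<in> carrier G \<Longrightarrow> closed U \<Longrightarrow> closed (\<phi> g -` U)"
  using continuous_act by (simp add: closed_vimage)

text \<open>The points whose orbit avoids \<open>U\<close> form a closed invariant set which misses
  \<open>U\<close>, so minimality leaves it empty.\<close>

lemma minimal_visits_open:
  assumes "minimal_system G \<phi>" "open U" "U \<noteq> {}"
  shows "\<exists>g\<in>carrier G. \<phi> g x \<in> U"
proof -
  let ?A = "\<Inter>g\<in>carrier G. \<phi> g -` (- U)"
  have "closed ?A"
    using assms(2) by (intro closed_INT ballI closed_act_vimage) auto
  moreover have "\<forall>g\<in>carrier G. \<phi> g ` ?A \<subseteq> ?A"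
    by (auto simp flip: act_mult)
  moreover have "?A \<noteq> UNIV"
  proof -
    obtain z where "z \<in> U" using assms(3) by blast
    then have "z \<notin> ?A" using act_one[of z] one_closed by (metis (lifting) ComplD INT_D vimageD)
    then show ?thesis by (metis UNIV_I)
  qed
  ultimately have "?A = {}"
    using assms(1)[unfolded minimal_system_def, THEN spec, of ?A] by satx
  then show ?thesis by blast
qed

lemma minimal_closure_orbit:
  assumes "minimal_system G \<phi>"
  shows "closure (orbit G \<phi> x) = UNIV"
proof -
  have "\<phi> g x \<in> closure (orbit G \<phi> x)" if "g \<in> carrier G" for g
    using that closure_subset[of "orbit G \<phi> x"] by (auto simp: orbit_def)
  then have "- closure (orbit G \<phi> x) = {}"
    using minimal_visits_open[OF assms, of "- closure (orbit G \<phi> x)" x] by blast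
  then show ?thesis by auto
qed

text \<open>If \<open>U\<close> were null, so would be its translates, finitely many of which cover
  the compact space, contradicting total mass 1.\<close>

lemma minimal_emeasure_open_pos:
  assumes "minimal_system G \<phi>" "invariant_probability G \<phi> \<mu>" "open U" "U \<noteq> {}"
  shows "emeasure \<mu> U > 0"
proof (rule ccontr)
  assume "\<not> emeasure \<mu> U > 0"
  then have U: "emeasure \<mu> U = 0" by simp
  have \<mu>: "prob_space \<mu>" "sets \<mu> = sets borel"
    "\<And>g A. g \<in> carrier G \<Longrightarrow> A \<in> sets borel \<Longrightarrow> emeasure \<mu> (\<phi> g ` A) = emeasure \<mu> A"
    using assms(2) by (auto simp: invariant_probability_def)
  have null: "\<phi> g -` U \<in> null_sets \<mu>" if "g \<in> carrier G" for g
  proof -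
    have "\<phi> g -` U = \<phi> (inv g) ` U" using that by (simp add: act_image)
    then show ?thesis
      using that U \<mu>(2,3) assms(3) open_act_vimage[OF that assms(3)]
      by (simp add: null_sets_def)
  qed
  have "UNIV \<subseteq> (\<Union>g\<in>carrier G. \<phi> g -` U)"
    using minimal_visits_open[OF assms(1,3,4)] by auto
  then obtain F where F: "F \<subseteq> carrier G" "finite F" "UNIV \<subseteq> (\<Union>g\<in>F. \<phi> g -` U)"
    using compactE_image[OF compact_space, of "carrier G" "\<lambda>g. \<phi> g -` U"]
      open_act_vimage assms(3) by metis
  have "(\<Union>g\<in>F. \<phi> g -` U) \<in> null_sets \<mu>"
    using F null by (intro null_sets_UN') (auto simp: countable_finite)
  with F(3) have "UNIV \<in> null_sets \<mu>" by (simp add: top.extremum_unique)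
  moreover have "space \<mu> = UNIV" using \<mu>(2) sets_eq_imp_space_eq by fastforce
  ultimately show False
    using prob_space.emeasure_space_1[OF \<mu>(1)] by (simp add: null_sets_def)
qed

section \<open>Proximality and its behaviour under limits\<close>

section \<open>The proximal relation\<close>

lemma proximal_iff:
  "(x, y) \<in> proximal_relation G \<phi> \<longleftrightarrow> (\<forall>\<epsilon>>0. \<exists>g\<in>carrier G. dist (\<phi> g x) (\<phi> g y) < \<epsilon>)"
proof -
  let ?f = "\<lambda>g. dist (\<phi> g x) (\<phi> g y)"
  have ne: "carrier G \<noteq> {}" and bdd: "bdd_below (?f ` carrier G)"
    by (auto intro: bdd_belowI2[of _ 0])
  have ge: "0 \<le> Inf (?f ` carrier G)"
    using ne by (auto intro: cINF_greatest)
  have "Inf (?f ` carrier G) = 0 \<longleftrightarrow> (\<forall>\<epsilon>>0. Inf (?f ` carrier G) < \<epsilon>)"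
    using ge by (metis order_le_less less_irrefl)
  then show ?thesis
    by (simp add: proximal_relation_def cINF_less_iff[OF ne bdd])
qed

lemma distal_pair_iff: "distal_pair G \<phi> x y \<longleftrightarrow> (x, y) \<notin> proximal_relation G \<phi>"
proof -
  have "0 \<le> (INF g\<in>carrier G. dist (\<phi> g x) (\<phi> g y))"
    by (rule cINF_greatest) auto
  then show ?thesis
    unfolding distal_pair_def proximal_relation_def by force
qed

lemma proximal_refl: "(x, x) \<in> proximal_relation G \<phi>"
  by (auto simp: proximal_iff)

lemma proximal_sym: "(x, y) \<in> proximal_relation G \<phi> \<Longrightarrow> (y, x) \<in> proximal_relation G \<phi>"
  by (simp add: proximal_iff dist_commute)

lemma proximal_act_iff:
  assumes "g \<in> carrier G"
  shows "(\<phi> g x, \<phi> g y) \<in> proximal_relation G \<phi> \<longleftrightarrow> (x, y) \<in> proximal_relation G \<phi>"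
proof -
  have "\<exists>h\<in>carrier G. dist (\<phi> h x) (\<phi> h y) < \<epsilon>"
    if "k \<in> carrier G" "dist (\<phi> k (\<phi> g x)) (\<phi> k (\<phi> g y)) < \<epsilon>" for k \<epsilon>
    using that assms by (intro bexI[of _ "k \<otimes> g"]) (auto simp: act_mult)
  moreover have "\<exists>h\<in>carrier G. dist (\<phi> h (\<phi> g x)) (\<phi> h (\<phi> g y)) < \<epsilon>"
    if "k \<in> carrier G" "dist (\<phi> k x) (\<phi> k y) < \<epsilon>" for k \<epsilon>
    using that assms by (intro bexI[of _ "k \<otimes> inv g"]) (auto simp: act_mult)
  ultimately show ?thesis
    unfolding proximal_iff by metis
qed

text \<open>Pulls proximality back from a limit pair: some \<open>h\<close> brings \<open>a\<close>
  and \<open>b\<close> close, and by continuity \<open>h \<otimes> g n\<close> does the same to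
  \<open>x\<close> and \<open>y\<close> for large \<open>n\<close>.\<close>

lemma proximal_if_limit:
  assumes g: "\<And>n::nat. g n \<in> carrier G"
    and lim: "(\<lambda>n. \<phi> (g n) x) \<longlonglongrightarrow> a" "(\<lambda>n. \<phi> (g n) y) \<longlonglongrightarrow> b"
    and ab: "(a, b) \<in> proximal_relation G \<phi>"
  shows "(x, y) \<in> proximal_relation G \<phi>"
  unfolding proximal_iff
proof (intro allI impI)
  fix \<epsilon> :: real assume "\<epsilon> > 0"
  then obtain h where h: "h \<in> carrier G" "dist (\<phi> h a) (\<phi> h b) < \<epsilon>"
    using ab unfolding proximal_iff by blast
  have "isCont (\<phi> h) z" for z
    using continuous_action[OF h(1)] by (simp add: continuous_on_eq_continuous_at)
  then have "(\<lambda>n. dist (\<phi> h (\<phi> (g n) x)) (\<phi> h (\<phi> (g n) y))) \<longlonglongrightarrow> dist (\<phi> h a) (\<phi> h b)"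
    using lim by (intro tendsto_dist) (metis isCont_tendsto_compose)+
  then have "eventually (\<lambda>n. dist (\<phi> h (\<phi> (g n) x)) (\<phi> h (\<phi> (g n) y)) < \<epsilon>) sequentially"
    using h(2) order_tendstoD(2) by blast
  then obtain n where "dist (\<phi> h (\<phi> (g n) x)) (\<phi> h (\<phi> (g n) y)) < \<epsilon>"
    by (auto simp: eventually_sequentially)
  then show "\<exists>k\<in>carrier G. dist (\<phi> k x) (\<phi> k y) < \<epsilon>"
    using h(1) g[of n] by (intro bexI[of _ "h \<otimes> g n"]) (auto simp: act_mult)
qed

lemma convergent_subseq:
  fixes f :: "nat \<Rightarrow> 'x"
  obtains l r where "strict_mono r" "(\<lambda>n. f (r n)) \<longlonglongrightarrow> l"
proof -
  have "seq_compact (UNIV :: 'x set)"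
    using compact_space by (simp add: compact_eq_seq_compact_metric)
  then obtain l r where "strict_mono r" "(f \<circ> r) \<longlonglongrightarrow> l"
    unfolding seq_compact_def by blast
  then show thesis using that by (simp add: o_def)
qed

lemma proximal_common_limit:
  assumes "(x, y) \<in> proximal_relation G \<phi>"
  obtains g w where "\<And>n::nat. g n \<in> carrier G"
    "(\<lambda>n. \<phi> (g n) x) \<longlonglongrightarrow> w" "(\<lambda>n. \<phi> (g n) y) \<longlonglongrightarrow> w"
proof -
  have "\<exists>h\<in>carrier G. dist (\<phi> h x) (\<phi> h y) < inverse (real (Suc n))" for n
    using assms unfolding proximal_iff by simp
  then obtain h where h: "\<And>n. h n \<in> carrier G"
    "\<And>n. dist (\<phi> (h n) x) (\<phi> (h n) y) < inverse (real (Suc n))" by metis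
  obtain r w where r: "strict_mono r" "(\<lambda>n. \<phi> (h (r n)) x) \<longlonglongrightarrow> w"
    by (rule convergent_subseq[of "\<lambda>n. \<phi> (h n) x"])
  have "(\<lambda>n. dist (\<phi> (h n) y) (\<phi> (h n) x)) \<longlonglongrightarrow> 0"
    by (rule real_tendsto_sandwich[OF _ _ tendsto_const LIMSEQ_inverse_real_of_nat])
      (use h(2) in \<open>auto simp: dist_commute less_imp_le\<close>)
  from LIMSEQ_subseq_LIMSEQ[OF this r(1)]
  have "(\<lambda>n. dist (\<phi> (h (r n)) y) (\<phi> (h (r n)) x)) \<longlonglongrightarrow> 0" by (simp add: o_def)
  from tendsto_add[OF this r(2)[THEN tendsto_dist_iff[THEN iffD1]]]
  have "(\<lambda>n. dist (\<phi> (h (r n)) y) (\<phi> (h (r n)) x) + dist (\<phi> (h (r n)) x) w) \<longlonglongrightarrow> 0"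
    by simp
  then have "(\<lambda>n. dist (\<phi> (h (r n)) y) w) \<longlonglongrightarrow> 0"
    by (rule real_tendsto_sandwich[OF _ _ tendsto_const, rotated 2])
      (auto simp: dist_triangle)
  then have "(\<lambda>n. \<phi> (h (r n)) y) \<longlonglongrightarrow> w"
    by (simp add: tendsto_dist_iff[of _ w])
  with r(2) h(1) that[of "\<lambda>n. h (r n)" w] show thesis by simp
qed

text \<open>Move \<open>x\<close> and \<open>y\<close> to a common limit \<open>w\<close> and let
  \<open>z\<close> tend to \<open>v\<close>. Closedness makes \<open>(w, v)\<close> proximal as a
  limit of translates of \<open>(y, z)\<close>; it is also a limit of translates of
  \<open>(x, z)\<close>, so proximality pulls back.\<close>

lemma proximal_trans:
  assumes "closed (proximal_relation G \<phi>)"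
    and xy: "(x, y) \<in> proximal_relation G \<phi>" and yz: "(y, z) \<in> proximal_relation G \<phi>"
  shows "(x, z) \<in> proximal_relation G \<phi>"
proof -
  obtain g w where g: "\<And>n::nat. g n \<in> carrier G"
    "(\<lambda>n. \<phi> (g n) x) \<longlonglongrightarrow> w" "(\<lambda>n. \<phi> (g n) y) \<longlonglongrightarrow> w"
    using proximal_common_limit[OF xy] by blast
  obtain r v where r: "strict_mono r" "(\<lambda>n. \<phi> (g (r n)) z) \<longlonglongrightarrow> v"
    by (rule convergent_subseq[of "\<lambda>n. \<phi> (g n) z"])
  have x: "(\<lambda>n. \<phi> (g (r n)) x) \<longlonglongrightarrow> w" and y: "(\<lambda>n. \<phi> (g (r n)) y) \<longlonglongrightarrow> w"
    using g(2,3)[THEN LIMSEQ_subseq_LIMSEQ, OF r(1)] by (simp_all add: o_def)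
  have "(w, v) \<in> proximal_relation G \<phi>"
    by (rule closed_sequentially[OF assms(1) _ tendsto_Pair[OF y r(2)]])
      (use g(1) yz in \<open>simp add: proximal_act_iff\<close>)
  then show ?thesis
    by (rule proximal_if_limit[OF g(1) x r(2)])
qed

lemma distal_structure_relation_eq_proximal:
  assumes "closed (proximal_relation G \<phi>)"
  shows "distal_structure_relation G \<phi> = proximal_relation G \<phi>"
proof
  have "equiv UNIV (proximal_relation G \<phi>)"
  proof (rule equivI)
    show "refl (proximal_relation G \<phi>)" by (simp add: refl_on_def proximal_refl)
    show "sym (proximal_relation G \<phi>)" by (rule symI) (rule proximal_sym)
    show "trans (proximal_relation G \<phi>)" by (rule transI) (rule proximal_trans[OF assms])
  qed simp
  then have "closed_invariant_equiv G \<phi> (proximal_relation G \<phi>)"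
    using assms by (auto simp: closed_invariant_equiv_def proximal_act_iff)
  then show "distal_structure_relation G \<phi> \<subseteq> proximal_relation G \<phi>"
    by (auto simp: distal_structure_relation_def)
qed (rule proximal_subset_distal_structure_relation)

section \<open>Singleton classes and the equivalence of (2) and (3)\<close>

lemma minimal_approaches:
  assumes "minimal_system G \<phi>"
  obtains g where "\<And>n::nat. g n \<in> carrier G" "(\<lambda>n. \<phi> (g n) x) \<longlonglongrightarrow> y"
proof -
  have "\<exists>h\<in>carrier G. \<phi> h x \<in> ball y (inverse (real (Suc n)))" for n
    by (rule minimal_visits_open[OF assms]) auto
  then obtain h where h: "\<And>n. h n \<in> carrier G"
    "\<And>n. dist y (\<phi> (h n) x) < inverse (real (Suc n))"
    by (metis mem_ball)
  have "(\<lambda>n. dist (\<phi> (h n) x) y) \<longlonglongrightarrow> 0"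
    by (rule real_tendsto_sandwich[OF _ _ tendsto_const LIMSEQ_inverse_real_of_nat])
      (use h(2) in \<open>auto simp: dist_commute less_imp_le\<close>)
  then show thesis
    using h(1) that tendsto_dist_iff by blast
qed

text \<open>Applied with \<open>R\<close> the distal structure relation and with \<open>R\<close>
  the closure of the proximal relation.\<close>

lemma closed_proximal_if_point:
  assumes "minimal_system G \<phi>" and R: "closed R" "proximal_relation G \<phi> \<subseteq> R"
    "\<And>g x y. g \<in> carrier G \<Longrightarrow> (x, y) \<in> R \<Longrightarrow> (\<phi> g x, \<phi> g y) \<in> R"
    and x0: "\<And>y. (x0, y) \<in> R \<Longrightarrow> y = x0"
  shows "proximal_relation G \<phi> = R"
proof (rule equalityI[OF R(2)], rule subrelI)
  fix x y assume xy: "(x, y) \<in> R"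
  obtain g where g: "\<And>n::nat. g n \<in> carrier G" "(\<lambda>n. \<phi> (g n) x) \<longlonglongrightarrow> x0"
    by (rule minimal_approaches[OF assms(1), of x x0]) blast
  obtain r v where r: "strict_mono r" "(\<lambda>n. \<phi> (g (r n)) y) \<longlonglongrightarrow> v"
    by (rule convergent_subseq[of "\<lambda>n. \<phi> (g n) y"])
  have x: "(\<lambda>n. \<phi> (g (r n)) x) \<longlonglongrightarrow> x0"
    using g(2)[THEN LIMSEQ_subseq_LIMSEQ, OF r(1)] by (simp add: o_def)
  \<comment> \<open>The limit pair stays in \<open>R\<close> and starts at \<open>x0\<close>, so it
    is diagonal and thus proximal.\<close>
  have "(x0, v) \<in> R"
    by (rule closed_sequentially[OF R(1) _ tendsto_Pair[OF x r(2)]]) (use g(1) xy R(3) in auto)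
  then have "v = x0" by (rule x0)
  then have "(x0, v) \<in> proximal_relation G \<phi>" by (simp add: proximal_refl)
  then show "(x, y) \<in> proximal_relation G \<phi>"
    by (rule proximal_if_limit[OF g(1) x r(2)])
qed

text \<open>Under minimality every orbit closure is the whole space, so \<open>y\<close> ranges over
  all other points.\<close>

lemma distal_point_iff:
  assumes "minimal_system G \<phi>"
  shows "distal_point G \<phi> x \<longleftrightarrow> (\<forall>y. (x, y) \<in> proximal_relation G \<phi> \<longrightarrow> y = x)"
  unfolding distal_point_def distal_pair_iff minimal_closure_orbit[OF assms] by blast

lemma singleton_fibre_iff:
  "is_singleton (max_distal_factor_map G \<phi> -` {max_distal_factor_map G \<phi> x}) \<longleftrightarrow>
     (\<forall>y. (x, y) \<in> distal_structure_relation G \<phi> \<longrightarrow> y = x)"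
proof -
  have eq: "equiv UNIV (distal_structure_relation G \<phi>)"
    using closed_invariant_equiv_distal_structure_relation[of G \<phi>]
    by (simp add: closed_invariant_equiv_def)
  have "max_distal_factor_map G \<phi> -` {max_distal_factor_map G \<phi> x} =
      distal_structure_relation G \<phi> `` {x}"
    using eq_equiv_class_iff[OF eq, of _ x] eq
    by (auto simp: max_distal_factor_map_def equiv_def sym_def)
  moreover have "(x, x) \<in> distal_structure_relation G \<phi>"
    using eq by (simp add: equiv_def refl_on_def)
  ultimately have "is_singleton (max_distal_factor_map G \<phi> -` {max_distal_factor_map G \<phi> x}) \<longleftrightarrow>
      distal_structure_relation G \<phi> `` {x} = {x}"
    unfolding is_singleton_def by force
  with \<open>(x, x) \<in> distal_structure_relation G \<phi>\<close> show ?thesis by blast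
qed

end

lemma closure_meets_open: "x \<in> closure S \<Longrightarrow> open U \<Longrightarrow> x \<in> U \<Longrightarrow> \<exists>y\<in>S. y \<in> U"
  using open_Int_closure_eq_empty by blast

lemma residual_mono: "residual A \<Longrightarrow> A \<subseteq> B \<Longrightarrow> residual B"
  unfolding residual_def by blast

lemma residual_nonempty: "residual A \<Longrightarrow> A \<noteq> {}"
  unfolding residual_def by auto

theorem (in dynamical_system) point_distal_iff_almost_one_to_one:
  assumes "minimal_system G \<phi>"
  shows "point_distal G \<phi> \<and> closed (proximal_relation G \<phi>) \<longleftrightarrow>
    almost_one_to_one_factor_map G \<phi> (max_distal_factor_topology G \<phi>)
      (max_distal_factor_action G \<phi>) (max_distal_factor_map G \<phi>)" (is "?l \<longleftrightarrow> ?r")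
proof
  \<comment> \<open>Closedness identifies the structure relation with proximality, so the points
    with singleton fibre are exactly the distal points.\<close>
  assume ?l
  then show ?r
    by (simp add: almost_one_to_one_factor_map_def factor_map_max_distal_factor_map
        singleton_fibre_iff distal_structure_relation_eq_proximal point_distal_def
        distal_point_iff[OF assms])
next
  assume ?r
  then have res: "residual {x. \<forall>y. (x, y) \<in> distal_structure_relation G \<phi> \<longrightarrow> y = x}"
    by (simp add: almost_one_to_one_factor_map_def singleton_fibre_iff)
  \<comment> \<open>A residual set is dense, hence nonempty; one singleton class is enough to make
    the proximal relation closed.\<close>
  then obtain x0 where x0: "\<And>y. (x0, y) \<in> distal_structure_relation G \<phi> \<Longrightarrow> y = x0"
    using residual_nonempty by blast
  have "proximal_relation G \<phi> = distal_structure_relation G \<phi>"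
    using closed_invariant_equiv_distal_structure_relation[of G \<phi>]
    by (intro closed_proximal_if_point[OF assms _ proximal_subset_distal_structure_relation _ x0])
      (auto simp: closed_invariant_equiv_def)
  then show ?l
    using res closed_invariant_equiv_distal_structure_relation[of G \<phi>]
    by (simp add: point_distal_def distal_point_iff[OF assms] closed_invariant_equiv_def)
qed

section \<open>From (1) to (2): recurrence inside IP-sets\<close>

section \<open>Equicontinuous points are distal\<close>

context dynamical_system
begin

text \<open>Minimality moves the common limit of \<open>x\<close> and \<open>y\<close> into
  \<open>V\<close>, hence also late terms of the two sequences.\<close>

lemma proximal_visits_open:
  assumes "minimal_system G \<phi>" "(x, y) \<in> proximal_relation G \<phi>" "open V" "V \<noteq> {}"
  obtains g where "g \<in> carrier G" "\<phi> g x \<in> V" "\<phi> g y \<in> V"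
proof -
  obtain g w where g: "\<And>n::nat. g n \<in> carrier G"
    "(\<lambda>n. \<phi> (g n) x) \<longlonglongrightarrow> w" "(\<lambda>n. \<phi> (g n) y) \<longlonglongrightarrow> w"
    using proximal_common_limit[OF assms(2)] by blast
  obtain h where h: "h \<in> carrier G" "\<phi> h w \<in> V"
    using minimal_visits_open[OF assms(1,3,4)] by blast
  have O: "open (\<phi> h -` V)" "w \<in> \<phi> h -` V"
    using h assms(3) by (auto intro: open_act_vimage)
  have "eventually (\<lambda>n. \<phi> (g n) x \<in> \<phi> h -` V \<and> \<phi> (g n) y \<in> \<phi> h -` V) sequentially"
    using topological_tendstoD[OF g(2) O] topological_tendstoD[OF g(3) O]
    by (rule eventually_conj)
  then obtain n where "\<phi> (g n) x \<in> \<phi> h -` V" "\<phi> (g n) y \<in> \<phi> h -` V"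
    by (auto simp: eventually_sequentially)
  then show thesis
    using that[of "h \<otimes> g n"] h(1) g(1) by (simp add: act_mult)
qed

text \<open>The stages are open neighbourhoods of \<open>y\<close>: if \<open>g\<close> sends
  \<open>x\<close> and \<open>y\<close> into \<open>A\<close>, the part of \<open>A\<close> that
  \<open>g\<close> keeps in \<open>A\<close> is again one.\<close>

lemma proximal_FP_near:
  assumes "minimal_system G \<phi>" "(x, y) \<in> proximal_relation G \<phi>" "open V" "y \<in> V"
  obtains p where "range p \<subseteq> carrier G" "\<And>g. g \<in> FP G p \<Longrightarrow> \<phi> g x \<in> V \<and> \<phi> g y \<in> V"
proof -
  have step: "\<exists>g\<in>carrier G. \<phi> g x \<in> A \<and> A \<inter> \<phi> g -` A \<in> {A. open A \<and> y \<in> A}"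
    if A: "A \<in> {A. open A \<and> y \<in> A}" for A
  proof -
    obtain g where "g \<in> carrier G" "\<phi> g x \<in> A" "\<phi> g y \<in> A"
      using proximal_visits_open[OF assms(1,2)] A by blast
    then show ?thesis using A open_act_vimage by blast
  qed
  obtain p A where p: "range p \<subseteq> carrier G" and A: "\<And>n. A n \<in> {A. open A \<and> y \<in> A}"
    "\<And>n. \<phi> (p n) x \<in> A n" "decseq A"
    "\<And>n \<alpha> w. \<alpha> \<subseteq> {..<n} \<Longrightarrow> w \<in> A n \<Longrightarrow> \<phi> (ordered_prod G p \<alpha>) w \<in> V"
    "\<And>n \<alpha> w. \<alpha> \<subseteq> {..<n} \<Longrightarrow> \<phi> (p n) w \<in> A n \<Longrightarrow> \<phi> (ordered_prod G p (insert n \<alpha>)) w \<in> V"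
    using exists_FP_in[of \<phi> "{A. open A \<and> y \<in> A}" "\<lambda>A g. \<phi> g x \<in> A" V, OF act_mult act_one step]
      assms(3,4) by blast
  have "\<phi> g x \<in> V \<and> \<phi> g y \<in> V" if "g \<in> FP G p" for g
  proof -
    obtain n \<alpha> where \<alpha>: "\<alpha> \<subseteq> {..<n}" "g = ordered_prod G p (insert n \<alpha>)"
      using \<open>g \<in> FP G p\<close> by (rule FP_elim)
    \<comment> \<open>\<open>y\<close> lies in every stage, so its product is read off at stage
      \<open>Suc n\<close>; \<open>x\<close> enters stage \<open>n\<close> only through
      \<open>p n\<close>.\<close>
    have "insert n \<alpha> \<subseteq> {..<Suc n}" using \<alpha>(1) by auto
    then have "\<phi> g y \<in> V" using A(1,4) \<alpha>(2) by blast
    moreover have "\<phi> g x \<in> V" using A(2,5) \<alpha> by blast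
    ultimately show ?thesis by simp
  qed
  with p that show thesis by blast
qed

text \<open>
  Poincare recurrence along an IP-set: two of the translates of \<open>B\<close> by the initial products
  \<open>p 0 \<cdots> p (n - 1)\<close> overlap, and their quotient is a product of consecutive terms.
\<close>

lemma FP_returns:
  assumes inv: "invariant_probability G \<phi> \<mu>" and p: "range p \<subseteq> carrier G"
    and B: "B \<in> sets borel" "emeasure \<mu> B > 0"
  obtains g where "g \<in> FP G p" "emeasure \<mu> (B \<inter> \<phi> g -` B) > 0"
proof -
  have \<mu>: "prob_space \<mu>" "sets \<mu> = sets borel"
    "\<And>g A. g \<in> carrier G \<Longrightarrow> A \<in> sets borel \<Longrightarrow> emeasure \<mu> (\<phi> g ` A) = emeasure \<mu> A"
    using inv by (auto simp: invariant_probability_def)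
  interpret prob_space \<mu> by fact
  have vim: "\<phi> g -` A \<in> sets borel" if "g \<in> carrier G" "A \<in> sets borel" for g A
    using that
    by (intro measurable_sets_borel[of _ borel] borel_measurable_continuous_onI continuous_act)
  have img: "\<phi> g ` A \<in> sets borel" if "g \<in> carrier G" "A \<in> sets borel" for g A
    using that by (simp add: act_image vim)
  define h where "h n = ordered_prod G p {..<n}" for n
  have h: "h n \<in> carrier G" for n
    by (simp add: h_def ordered_prod_closed[OF p])
  have False if null: "\<And>g. g \<in> FP G p \<Longrightarrow> emeasure \<mu> (B \<inter> \<phi> g -` B) = 0"
  proof -
    have lt: "AE x in \<mu>. x \<notin> \<phi> (h m) ` B \<or> x \<notin> \<phi> (h n) ` B" if "m < n" for m n
    proof -
      define g where "g = ordered_prod G p {m..<n}"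
      have g: "g \<in> FP G p" "g \<in> carrier G"
        using \<open>m < n\<close> ordered_prod_closed[OF p] by (auto simp: g_def FP_def)
      have "ordered_prod G p ({..<m} \<union> {m..<n}) = h m \<otimes> g"
        unfolding h_def g_def by (rule ordered_prod_Un[OF p]) auto
      moreover have "{..<m} \<union> {m..<n} = {..<n}" using \<open>m < n\<close> by auto
      ultimately have hn: "h n = h m \<otimes> g"
        by (simp add: h_def)
      \<comment> \<open>A common point of the two translates comes from a point of \<open>B\<close>
        which \<open>g\<close> returns to \<open>B\<close>, so by invariance the overlap is
        null.\<close>
      have "\<phi> (h m) ` B \<inter> \<phi> (h n) ` B \<subseteq> \<phi> (h m \<otimes> g) ` (B \<inter> \<phi> g -` B)"
      proof
        fix w assume "w \<in> \<phi> (h m) ` B \<inter> \<phi> (h n) ` B"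
        then obtain b c where bc: "b \<in> B" "c \<in> B" "w = \<phi> (h m) b" "w = \<phi> (h m) (\<phi> g c)"
          using hn h g(2) by (auto simp: act_mult)
        then have "\<phi> g c = b" using act_inv(1)[OF h] by metis
        with bc h g(2) show "w \<in> \<phi> (h m \<otimes> g) ` (B \<inter> \<phi> g -` B)"
          by (intro image_eqI[of _ _ c]) (auto simp: act_mult)
      qed
      moreover have "\<phi> (h m \<otimes> g) ` (B \<inter> \<phi> g -` B) \<in> null_sets \<mu>"
      proof -
        have "B \<inter> \<phi> g -` B \<in> sets borel" using B(1) vim[OF g(2) B(1)] by (rule sets.Int)
        then show ?thesis
          using null[OF g(1)] h g(2) by (simp add: null_sets_def \<mu>(2,3) img)
      qed
      ultimately show ?thesis
        by (intro AE_I'[of "\<phi> (h m \<otimes> g) ` (B \<inter> \<phi> g -` B)"]) auto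
    qed
    have pair: "pairwise (\<lambda>m n. AE x in \<mu>. x \<notin> \<phi> (h m) ` B \<or> x \<notin> \<phi> (h n) ` B) I" for I
      unfolding pairwise_def
    proof (intro ballI impI)
      fix m n :: nat assume "m \<noteq> n"
      then consider "m < n" | "n < m" by linarith
      then show "AE x in \<mu>. x \<notin> \<phi> (h m) ` B \<or> x \<notin> \<phi> (h n) ` B"
      proof cases
        case 1
        then show ?thesis by (rule lt)
      next
        case 2
        from lt[OF 2] show ?thesis by (rule eventually_mono) blast
      qed
    qed
    have meas: "measure \<mu> (\<phi> (h n) ` B) = measure \<mu> B" for n
      using h B(1) \<mu>(3) by (simp add: measure_def)
    \<comment> \<open>Any number of translates of equal measure, disjoint up to null sets, must fit
      into total mass 1.\<close>
    have "real N * measure \<mu> B \<le> 1" for N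
    proof -
      have "measure \<mu> (\<Union>n\<in>{..<N}. \<phi> (h n) ` B) = (\<Sum>n<N. measure \<mu> (\<phi> (h n) ` B))"
        using img h B(1) \<mu>(2) by (intro measure_UNION_AE pair) (auto simp: fmeasurable_eq_sets)
      then show ?thesis
        using prob_le_1[of "\<Union>n\<in>{..<N}. \<phi> (h n) ` B"] by (simp add: meas)
    qed
    moreover have "measure \<mu> B > 0"
      using B(2) by (simp add: emeasure_eq_measure)
    ultimately show False
      using reals_Archimedean3 not_le by metis
  qed
  then show thesis
    using that by (metis not_gr_zero)
qed

text \<open>Runs the construction on pairs, so that one IP-set both sends \<open>x\<close> near
  \<open>y\<close> and keeps some point in \<open>B\<close>.\<close>

lemma proximal_FP_confined:
  assumes min: "minimal_system G \<phi>" and inv: "invariant_probability G \<phi> \<mu>"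
    and xy: "(x, y) \<in> proximal_relation G \<phi>" and V: "open V" "y \<in> V"
    and B: "closed B" "interior B \<noteq> {}"
  obtains p z where "range p \<subseteq> carrier G" "z \<in> B"
    "\<And>g. g \<in> FP G p \<Longrightarrow> \<phi> g x \<in> V \<and> \<phi> g z \<in> B"
proof -
  have sets: "sets \<mu> = sets borel"
    using inv by (simp add: invariant_probability_def)
  \<comment> \<open>The factor \<open>C\<close> has positive measure for the sake of recurrence and
    is closed so that compactness can finally produce \<open>z\<close>.\<close>
  define \<F> where "\<F> = {W \<times> C | W C. open W \<and> y \<in> W \<and> closed C \<and> emeasure \<mu> C > 0}"
  define \<psi> where "\<psi> g = map_prod (\<phi> g) (\<phi> g)" for g
  have step: "\<exists>g\<in>carrier G. (\<exists>z. \<psi> g (x, z) \<in> A) \<and> A \<inter> \<psi> g -` A \<in> \<F>" if "A \<in> \<F>" for A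
  proof -
    obtain W C where A: "A = W \<times> C" "open W" "y \<in> W" "closed C" "emeasure \<mu> C > 0"
      using \<open>A \<in> \<F>\<close> by (auto simp: \<F>_def)
    \<comment> \<open>Recurrence is used inside an IP-set that already sends \<open>x\<close> and
      \<open>y\<close> into \<open>W\<close>, so one \<open>g\<close> serves both factors.\<close>
    obtain p where p: "range p \<subseteq> carrier G"
      "\<And>g. g \<in> FP G p \<Longrightarrow> \<phi> g x \<in> W \<and> \<phi> g y \<in> W"
      using proximal_FP_near[OF min xy A(2,3)] by blast
    obtain g where g: "g \<in> FP G p" "emeasure \<mu> (C \<inter> \<phi> g -` C) > 0"
      using FP_returns[OF inv p(1) borel_closed[OF A(4)] A(5)] by blast
    have gG: "g \<in> carrier G"
      using g(1) ordered_prod_closed[OF p(1)] by (auto simp: FP_def)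
    have "C \<noteq> {}" using A(5) by auto
    then obtain c where "c \<in> C" by blast
    then have "\<psi> g (x, \<phi> (inv g) c) \<in> A"
      using p(2)[OF g(1)] gG by (simp add: A(1) \<psi>_def)
    moreover have "A \<inter> \<psi> g -` A = (W \<inter> \<phi> g -` W) \<times> (C \<inter> \<phi> g -` C)"
      by (auto simp: A(1) \<psi>_def)
    then have "A \<inter> \<psi> g -` A \<in> \<F>"
      using A(2-4) p(2)[OF g(1)] g(2) gG open_act_vimage[OF gG A(2)] closed_act_vimage[OF gG A(4)]
      unfolding \<F>_def by blast
    ultimately show ?thesis using gG by blast
  qed
  have "emeasure \<mu> (interior B) \<le> emeasure \<mu> B"
    using B(1) sets by (intro emeasure_mono interior_subset) simp
  then have "emeasure \<mu> B > 0"
    using minimal_emeasure_open_pos[OF min inv open_interior B(2)] by simp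
  with V B(1) have VB: "V \<times> B \<in> \<F>"
    unfolding \<F>_def by blast
  have \<psi>mult: "\<psi> (g \<otimes> h) w = \<psi> g (\<psi> h w)" if "g \<in> carrier G" "h \<in> carrier G" for g h w
    using that by (cases w) (simp add: \<psi>_def act_mult)
  have \<psi>one: "\<psi> \<one> w = w" for w
    by (cases w) (simp add: \<psi>_def)
  obtain p A where p: "range p \<subseteq> carrier G" and A: "\<And>n. A n \<in> \<F>"
    "\<And>n. \<exists>z. \<psi> (p n) (x, z) \<in> A n" "decseq A"
    "\<And>n \<alpha> w. \<alpha> \<subseteq> {..<n} \<Longrightarrow> w \<in> A n \<Longrightarrow> \<psi> (ordered_prod G p \<alpha>) w \<in> V \<times> B"
    "\<And>n \<alpha> w. \<alpha> \<subseteq> {..<n} \<Longrightarrow> \<psi> (p n) w \<in> A n \<Longrightarrow> \<psi> (ordered_prod G p (insert n \<alpha>)) w \<in> V \<times> B"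
    using exists_FP_in[of \<psi> \<F> "\<lambda>A g. \<exists>z. \<psi> g (x, z) \<in> A", OF \<psi>mult \<psi>one step VB] by blast
  \<comment> \<open>The second factors are nonempty, closed and decreasing; a common point
    \<open>z\<close> stays in \<open>B\<close> under all products.\<close>
  have "(\<Inter>n. snd ` A n) \<noteq> {}"
  proof (rule compact_decseq_Inter_nonempty[OF compact_space])
    show "decseq (\<lambda>n. snd ` A n)"
      using A(3) by (auto simp: decseq_def)
    fix n
    obtain W C where "A n = W \<times> C" "y \<in> W" "closed C" "emeasure \<mu> C > 0"
      using A(1)[of n] by (auto simp: \<F>_def)
    then show "closed (snd ` A n)" "snd ` A n \<noteq> {}"
      by (auto simp: snd_image_times)
  qed
  then obtain z where z: "\<And>n. z \<in> snd ` A n" by blast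
  have zB: "\<phi> (ordered_prod G p \<alpha>) z \<in> B" if \<alpha>: "\<alpha> \<subseteq> {..<n}" for \<alpha> n
  proof -
    obtain c where "(c, z) \<in> A n" using z[of n] by auto
    from A(4)[OF \<alpha> this] show ?thesis by (simp add: \<psi>_def)
  qed
  have "\<phi> g x \<in> V \<and> \<phi> g z \<in> B" if "g \<in> FP G p" for g
  proof -
    obtain n \<alpha> where \<alpha>: "\<alpha> \<subseteq> {..<n}" "g = ordered_prod G p (insert n \<alpha>)"
      using \<open>g \<in> FP G p\<close> by (rule FP_elim)
    obtain c where "\<psi> (p n) (x, c) \<in> A n" using A(2) by blast
    from A(5)[OF \<alpha>(1) this] have "\<phi> g x \<in> V" by (simp add: \<psi>_def \<alpha>(2))
    moreover have "insert n \<alpha> \<subseteq> {..<Suc n}" using \<alpha>(1) by auto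
    ultimately show ?thesis using zB \<alpha>(2) by blast
  qed
  moreover have "z \<in> B" using zB[of "{}" 0] by simp
  ultimately show thesis using that p by blast
qed

lemma equicontinuous_point_closure_proximal:
  assumes min: "minimal_system G \<phi>" and inv: "invariant_probability G \<phi> \<mu>"
    and x: "pairwise_IP_star_equicontinuous_point G \<phi> x"
    and xy: "(x, y) \<in> closure (proximal_relation G \<phi>)"
  shows "y = x"
proof (rule ccontr)
  assume "y \<noteq> x"
  \<comment> \<open>A third of the distance, since three distances below \<open>r\<close> are to
    bound \<open>dist x y\<close>.\<close>
  define r where "r = dist x y / 3"
  have "r > 0" using \<open>y \<noteq> x\<close> by (simp add: r_def)
  then obtain U where U: "open U" "x \<in> U"
    "\<And>a b. a \<in> U \<Longrightarrow> b \<in> U \<Longrightarrow> IP_star_set G {g \<in> carrier G. dist (\<phi> g a) (\<phi> g b) < r}"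
    using x unfolding pairwise_IP_star_equicontinuous_point_def by meson
  have "open (U \<times> ball y r)" "(x, y) \<in> U \<times> ball y r"
    using U \<open>r > 0\<close> by (auto intro: open_Times)
  then obtain a b where ab: "(a, b) \<in> proximal_relation G \<phi>" "a \<in> U" "b \<in> ball y r"
    using closure_meets_open[OF xy] by blast
  \<comment> \<open>Confinement takes a closed set. Inside \<open>U\<close> it lets equicontinuity
    compare \<open>a\<close> with \<open>z\<close>; inside \<open>ball x r\<close> it keeps the
    images of \<open>z\<close> away from \<open>y\<close>.\<close>
  have "open (U \<inter> ball x r)" "x \<in> U \<inter> ball x r" using U \<open>r > 0\<close> by auto
  then obtain s where s: "s > 0" "cball x s \<subseteq> U \<inter> ball x r"
    by (meson open_contains_cball)
  have "x \<in> interior (cball x s)"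
    using s(1) by (meson ball_subset_cball centre_in_ball interior_maximal open_ball subsetD)
  then have int: "interior (cball x s) \<noteq> {}" by blast
  obtain p z where p: "range p \<subseteq> carrier G" "z \<in> cball x s"
    "\<And>g. g \<in> FP G p \<Longrightarrow> \<phi> g a \<in> ball y r \<and> \<phi> g z \<in> cball x s"
    using proximal_FP_confined[OF min inv ab(1) open_ball ab(3) closed_cball int] by blast
  have "z \<in> U" using p(2) s(2) by blast
  then obtain g where g: "g \<in> FP G p" "dist (\<phi> g a) (\<phi> g z) < r"
    using U(3)[OF ab(2)] IP_set_FP[OF p(1)] unfolding IP_star_set_def by blast
  then have "dist y (\<phi> g a) < r" "dist x (\<phi> g z) < r"
    using p(3) s(2) by (auto simp: subset_iff)
  moreover have "dist x y \<le> dist x (\<phi> g z) + dist (\<phi> g z) (\<phi> g a) + dist (\<phi> g a) y"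
    using dist_triangle[of x y "\<phi> g z"] dist_triangle[of "\<phi> g z" y "\<phi> g a"] by linarith
  ultimately show False
    using g(2) by (simp add: r_def dist_commute)
qed

lemma closure_proximal_invariant:
  assumes g: "g \<in> carrier G" and xy: "(x, y) \<in> closure (proximal_relation G \<phi>)"
  shows "(\<phi> g x, \<phi> g y) \<in> closure (proximal_relation G \<phi>)"
proof -
  let ?f = "\<lambda>w. (\<phi> g (fst w), \<phi> g (snd w))"
  have "continuous_on UNIV ?f"
    by (intro continuous_intros continuous_on_compose2[OF continuous_act[OF g, of UNIV]]) auto
  moreover have "?f ` proximal_relation G \<phi> \<subseteq> closure (proximal_relation G \<phi>)"
    using proximal_act_iff[OF g] by (auto intro!: subsetD[OF closure_subset])
  ultimately have "?f ` closure (proximal_relation G \<phi>) \<subseteq> closure (proximal_relation G \<phi>)"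
    by (intro image_closure_subset) (auto intro: continuous_on_subset)
  with xy show ?thesis by fastforce
qed

theorem almost_equicontinuous_imp_point_distal:
  assumes min: "minimal_system G \<phi>" and inv: "invariant_probability G \<phi> \<mu>"
    and eq: "almost_pairwise_IP_star_equicontinuous G \<phi>"
  shows "point_distal G \<phi>" "closed (proximal_relation G \<phi>)"
proof -
  have res: "residual {x. pairwise_IP_star_equicontinuous_point G \<phi> x}"
    using eq by (simp add: almost_pairwise_IP_star_equicontinuous_def)
  then obtain x0 where x0: "pairwise_IP_star_equicontinuous_point G \<phi> x0"
    using residual_nonempty by blast
  \<comment> \<open>A single equicontinuous point suffices here, since the closure relates it to
    itself only.\<close>
  have "proximal_relation G \<phi> = closure (proximal_relation G \<phi>)"
    by (rule closed_proximal_if_point[OF min closed_closure closure_subset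
          closure_proximal_invariant equicontinuous_point_closure_proximal[OF min inv x0]])
  then show "closed (proximal_relation G \<phi>)"
    by (metis closed_closure)
  show "point_distal G \<phi>"
    unfolding point_distal_def
  proof (rule residual_mono[OF res], rule subsetI)
    fix x assume "x \<in> {x. pairwise_IP_star_equicontinuous_point G \<phi> x}"
    then have "y = x" if "(x, y) \<in> proximal_relation G \<phi>" for y
      using that equicontinuous_point_closure_proximal[OF min inv] closure_subset by blast
    then show "x \<in> {x. distal_point G \<phi> x}"
      by (simp add: distal_point_iff[OF min])
  qed
qed

section \<open>From (2) to (1): idempotent limits of IP-sets\<close>

section \<open>Distal points are equicontinuous\<close>

text \<open>The maps in the closure of every tail form a closed semigroup. An idempotent
  \<open>u\<close> in it sends \<open>y\<close> and \<open>u y\<close> to the same point, so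
  elements of the IP-set near \<open>u\<close> bring them close together.\<close>

lemma FP_limit_proximal:
  assumes p: "range p \<subseteq> carrier G"
  obtains u where "\<And>y. (y, u y) \<in> proximal_relation G \<phi>" "u \<in> closure (\<phi> ` FP G p)"
proof -
  define T where "T n = (\<lambda>\<alpha>. \<phi> (ordered_prod G p \<alpha>)) ` {\<alpha>. finite \<alpha> \<and> \<alpha> \<noteq> {} \<and> \<alpha> \<subseteq> {n..}}" for n
  define S where "S = (\<Inter>n. closure (T n))"
  have T0: "T 0 = \<phi> ` FP G p"
    by (auto simp: T_def FP_def)
  have dec: "decseq (\<lambda>n. closure (T n))"
    unfolding decseq_def T_def by (intro allI impI closure_mono image_mono) fastforce
  have ne: "T n \<noteq> {}" for n
    unfolding T_def by (auto intro: exI[of _ "{n}"])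
  \<comment> \<open>Left composition with \<open>t\<close> is continuous because \<open>t\<close> is
    a translation, and it sends a late tail into \<open>T n\<close>.\<close>
  have left: "t \<circ> r \<in> closure (T n)" if t: "t \<in> T n" and r: "r \<in> S" for t r n
  proof -
    obtain \<alpha> where \<alpha>: "t = \<phi> (ordered_prod G p \<alpha>)" "finite \<alpha>" "\<alpha> \<noteq> {}" "\<alpha> \<subseteq> {n..}"
      using t by (auto simp: T_def)
    \<comment> \<open>Past the greatest index of \<open>\<alpha>\<close>, so that the two products
      combine to the product over the union.\<close>
    define m where "m = Suc (Max \<alpha>)"
    have lt: "i < j" if "i \<in> \<alpha>" "j \<in> \<beta>" "\<beta> \<subseteq> {m..}" for i j \<beta>
    proof -
      have "m \<le> j" "i \<le> Max \<alpha>" using that \<alpha>(2) by auto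
      then show ?thesis by (simp add: m_def)
    qed
    have "t \<circ> q \<in> T n" if q: "q \<in> T m" for q
    proof -
      obtain \<beta> where \<beta>: "q = \<phi> (ordered_prod G p \<beta>)" "finite \<beta>" "\<beta> \<noteq> {}" "\<beta> \<subseteq> {m..}"
        using q by (auto simp: T_def)
      have "t \<circ> q = \<phi> (ordered_prod G p (\<alpha> \<union> \<beta>))"
        using \<alpha> \<beta> lt ordered_prod_closed[OF p]
        by (simp add: fun_eq_iff ordered_prod_Un[OF p] act_mult)
      moreover have "Max \<alpha> \<in> {n..}"
        using \<alpha>(4) Max_in[OF \<alpha>(2,3)] by blast
      then have "n \<le> m" by (simp add: m_def)
      then have "\<alpha> \<union> \<beta> \<subseteq> {n..}" using \<alpha>(4) \<beta>(4) by auto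
      ultimately show ?thesis using \<alpha> \<beta> by (auto simp: T_def)
    qed
    moreover have "continuous_on UNIV (\<lambda>q :: 'x \<Rightarrow> 'x. t \<circ> q)"
      unfolding comp_def \<alpha>(1)
      by (intro continuous_on_coordinatewise_then_product
          continuous_on_compose2[OF continuous_act[OF ordered_prod_closed[OF p], of UNIV]]) auto
    ultimately have "(\<lambda>q. t \<circ> q) ` closure (T m) \<subseteq> closure (T n)"
      using closure_subset[of "T n"]
      by (intro image_closure_subset) (auto intro: continuous_on_subset)
    then show ?thesis using r by (auto simp: S_def)
  qed
  \<comment> \<open>Right composition with any \<open>r\<close> is continuous, which extends
    \<open>left\<close> from \<open>T n\<close> to its closure.\<close>
  have comp: "q \<circ> r \<in> S" if q: "q \<in> S" and r: "r \<in> S" for q r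
  proof -
    have "(\<lambda>q. q \<circ> r) ` closure (T n) \<subseteq> closure (T n)" for n
      using left[OF _ r]
      by (intro image_closure_subset continuous_on_subset[OF continuous_on_comp_right]) auto
    then show ?thesis using q by (auto simp: S_def)
  qed
  have "S \<noteq> {}"
    unfolding S_def using ne
    by (intro compact_decseq_Inter_nonempty[OF compact_UNIV_fun[OF compact_space] dec]) auto
  moreover have "closed S" unfolding S_def by blast
  ultimately obtain u where u: "u \<in> S" "u \<circ> u = u"
    using exists_idempotent[OF compact_space _ _ comp] by metis
  have uT: "u \<in> closure (\<phi> ` FP G p)" using u(1) by (auto simp: S_def simp flip: T0)
  have "(y, u y) \<in> proximal_relation G \<phi>" for y
    unfolding proximal_iff
  proof (intro allI impI)
    fix \<epsilon> :: real assume "\<epsilon> > 0"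
    have "continuous_on UNIV (\<lambda>q :: 'x \<Rightarrow> 'x. dist (q y) (q (u y)))"
      by (intro continuous_on_dist continuous_on_product_coordinates)
    then have "open ((\<lambda>q :: 'x \<Rightarrow> 'x. dist (q y) (q (u y))) -` {..<\<epsilon>})"
      by (rule open_vimage[rotated]) simp
    moreover have "u (u y) = u y" using u(2) by (metis comp_apply)
    ultimately obtain g where "g \<in> FP G p" "dist (\<phi> g y) (\<phi> g (u y)) < \<epsilon>"
      using closure_meets_open[OF uT] \<open>\<epsilon> > 0\<close> by fastforce
    moreover have "g \<in> carrier G"
      using \<open>g \<in> FP G p\<close> ordered_prod_closed[OF p] by (auto simp: FP_def)
    ultimately show "\<exists>g\<in>carrier G. dist (\<phi> g y) (\<phi> g (u y)) < \<epsilon>" by blast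
  qed
  with uT that show thesis by blast
qed

lemma distal_point_imp_equicontinuous_point:
  assumes P: "closed (proximal_relation G \<phi>)"
    and x: "\<And>y. (x, y) \<in> proximal_relation G \<phi> \<Longrightarrow> y = x"
  shows "pairwise_IP_star_equicontinuous_point G \<phi> x"
  unfolding pairwise_IP_star_equicontinuous_point_def
proof (intro allI impI)
  fix \<epsilon> :: real assume "\<epsilon> > 0"
  let ?V = "ball x (\<epsilon> / 2)"
  \<comment> \<open>\<open>fst\<close> maps \<open>C\<close> onto the points having a proximal
    partner outside \<open>?V\<close>; by compactness this set is closed, and it misses
    \<open>x\<close>.\<close>
  define C where "C = proximal_relation G \<phi> \<inter> UNIV \<times> (- ?V)"
  have "compact (UNIV :: ('x \<times> 'x) set)"
    using compact_Times[OF compact_space compact_space] by simp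
  moreover have "closed C"
    unfolding C_def using P by (intro closed_Int closed_Times) auto
  ultimately have "compact C"
    by (metis closed_Int_compact inf_top.right_neutral)
  then have "closed (fst ` C)"
    by (intro compact_imp_closed compact_continuous_image continuous_on_fst continuous_on_id)
  then have "open (- (fst ` C))" by (rule open_Compl)
  moreover have "x \<in> - (fst ` C)"
    using x \<open>\<epsilon> > 0\<close> by (force simp: C_def)
  moreover have "IP_star_set G {g \<in> carrier G. dist (\<phi> g y) (\<phi> g z) < \<epsilon>}"
    if yz: "y \<in> - (fst ` C)" "z \<in> - (fst ` C)" for y z
    unfolding IP_star_set_def
  proof (intro conjI allI impI)
    fix E assume "IP_set G E"
    then obtain p where p: "range p \<subseteq> carrier G" "FP G p \<subseteq> E" and E: "E \<subseteq> carrier G"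
      by (auto simp: IP_set_def)
    obtain u where u: "\<And>w. (w, u w) \<in> proximal_relation G \<phi>" "u \<in> closure (\<phi> ` FP G p)"
      using FP_limit_proximal[OF p(1)] by blast
    have V: "u y \<in> ?V" "u z \<in> ?V"
      using yz u(1) by (force simp: C_def)+
    have "open {q :: 'x \<Rightarrow> 'x. q w \<in> ?V}" for w
      using open_vimage[OF open_ball[of x "\<epsilon> / 2"] continuous_on_product_coordinates[of w]]
      by (simp only: vimage_def)
    \<comment> \<open>A condition at the two coordinates \<open>y\<close> and \<open>z\<close> is
      open in the pointwise topology, so a single \<open>g\<close> near \<open>u\<close> meets
      both.\<close>
    then have "open ({q :: 'x \<Rightarrow> 'x. q y \<in> ?V} \<inter> {q. q z \<in> ?V})" by blast
    then obtain g where g: "g \<in> FP G p" "\<phi> g y \<in> ?V" "\<phi> g z \<in> ?V"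
      using closure_meets_open[OF u(2)] V by blast
    then have "dist (\<phi> g y) (\<phi> g z) < \<epsilon>"
      using dist_triangle_half_r[of x "\<phi> g y" \<epsilon> "\<phi> g z"] by simp
    with g(1) p E show "{g \<in> carrier G. dist (\<phi> g y) (\<phi> g z) < \<epsilon>} \<inter> E \<noteq> {}" by blast
  qed auto
  ultimately show "\<exists>U. open U \<and> x \<in> U \<and>
      (\<forall>y\<in>U. \<forall>z\<in>U. IP_star_set G {g \<in> carrier G. dist (\<phi> g y) (\<phi> g z) < \<epsilon>})"
    by blast
qed

theorem point_distal_imp_almost_equicontinuous:
  assumes min: "minimal_system G \<phi>"
    and "point_distal G \<phi>" "closed (proximal_relation G \<phi>)"
  shows "almost_pairwise_IP_star_equicontinuous G \<phi>"
  unfolding almost_pairwise_IP_star_equicontinuous_def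
proof (rule residual_mono)
  show "residual {x. distal_point G \<phi> x}" using assms(2) by (simp add: point_distal_def)
  show "{x. distal_point G \<phi> x} \<subseteq> {x. pairwise_IP_star_equicontinuous_point G \<phi> x}"
    using distal_point_imp_equicontinuous_point[OF assms(3)] by (auto simp: distal_point_iff[OF min])
qed

end

theorem theorem3p13:
  fixes G :: "('g, 'b) monoid_scheme"
    and \<phi> :: "'g \<Rightarrow> 'x::metric_space \<Rightarrow> 'x"
  assumes "dynamical_system G \<phi>"
    and "minimal_system G \<phi>"
    and "\<exists>\<mu>. invariant_probability G \<phi> \<mu>"
  shows
    "(almost_pairwise_IP_star_equicontinuous G \<phi> \<longleftrightarrow>
        point_distal G \<phi> \<and> closed (proximal_relation G \<phi>)) \<and>
     (point_distal G \<phi> \<and> closed (proximal_relation G \<phi>) \<longleftrightarrow>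
        almost_one_to_one_factor_map G \<phi> (max_distal_factor_topology G \<phi>)
          (max_distal_factor_action G \<phi>) (max_distal_factor_map G \<phi>))"
proof -
  interpret dynamical_system G \<phi> by fact
  obtain \<mu> where "invariant_probability G \<phi> \<mu>" using assms(3) by blast
  then show ?thesis
    using almost_equicontinuous_imp_point_distal[OF assms(2)]
      point_distal_imp_almost_equicontinuous[OF assms(2)]
      point_distal_iff_almost_one_to_one[OF assms(2)] by metis
qed

end
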